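(* Let $\Omega\subset\mathbb{R}^2$ be the spatial domain, let $g>0$ be the gravity constant, $\kappa_s>0$ the Strickler coefficient and $\Delta t>0$ the time step. The semi-discrete scheme for the shallow water equations that advances $(\eta^n,\mathbf{q}^n)$ to $(\eta^{n+1},\mathbf{q}^{n+1})$ through $$\mathbf{q}^* = \mathbf{q}^n - \Delta t\,\nabla\cdot\left(\mathbf{v}^n\otimes\mathbf{q}^n\right),$$ $$\eta^{n+1} - \Delta t^2\, g\,\nabla\cdot\left(\frac{h^n}{1+\Delta t\,\gamma^n}\nabla\eta^{n+1}\right) = \eta^n - \Delta t\,\nabla\cdot\left(\frac{1}{1+\Delta t\,\gamma^n}\,\mathbf{q}^*\right),$$ $$\mathbf{q}^{n+1} = \frac{1}{1+\Delta t\,\gamma^n}\left(\mathbf{q}^* - \Delta t\, g\, h^n\,\nabla\eta^{n+1}\right)$$ is well balanced. That is, for an arbitrary time-independent bottom topography $b$ and any constant $\eta_0$ (with water depth $h^n=\eta_0-b>0$), if $\eta^n=\eta_0$ and $\mathbf{v}^n=\mathbf{0}$ in $\Omega$, then the lake-at-rest state is preserved by the scheme: $\eta^{n+1}=\eta_0$, $\mathbf{q}^{n+1}=\mathbf{0}$ is a solution of the equations $\eta^{n+1} - \Delta t^2\, g\,\nabla\cdot\left(\frac{h^n}{1+\Delta t\,\gamma^n}\nabla\eta^{n+1}\right) = \eta^n - \Delta t\,\nabla\cdot\left(\frac{1}{1+\Delta t\,\gamma^n}\,\mathbf{q}^*\right)$ and $\mathbf{q}^{n+1} = \frac{1}{1+\Delta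 t\,\gamma^n}\left(\mathbf{q}^* - \Delta t\, g\, h^n\,\nabla\eta^{n+1}\right)$ with $\mathbf{q}^* = \mathbf{q}^n - \Delta t\,\nabla\cdot\left(\mathbf{v}^n\otimes\mathbf{q}^n\right)$.
   Context: The shallow water equations with bottom friction are $\partial_t\eta+\nabla\cdot\mathbf{q}=0$, $\partial_t\mathbf{q}+\nabla\cdot(\mathbf{v}\otimes\mathbf{q})+gh\nabla\eta=-\gamma\mathbf{q}$, $\partial_t b=0$, for $\mathbf{x}\in\Omega\subset\mathbb{R}^2$, $t\ge 0$. Here $b=b(\mathbf{x})$ is the bottom elevation (constant in time), $h$ is the water depth, $\eta=h+b$ is the free surface elevation, $\mathbf{v}$ is the velocity field with values in $\mathbb{R}^2$, $\mathbf{q}=h\mathbf{v}$ is the momentum, and $\gamma=\dfrac{g}{\kappa_s^2h^{4/3}}|\mathbf{v}|$. The scheme is discrete in time and continuous in space. A superscript $n$ denotes the approximation at time $t^n$, and $t^{n+1}=t^n+\Delta t$. At every time level $h^n=\eta^n-b$, $\mathbf{q}^n=h^n\mathbf{v}^n$ and $\gamma^n=\dfrac{g}{\kappa_s^2(h^n)^{4/3}}|\mathbf{v}^n|$. The gradient $\nabla$ and divergence $\nabla\cdot$ act in the spatial variable $\mathbf{x}$, and $\nabla\cdot(\mathbf{v}\otimes\mathbf{q})$ is the vector with components $\sum_j\partial_{x_j}(v_jq_i)$. A scheme is called well balanced (or is said to satisfy the C-property) if it preserves steady state solutions of lake-at-rest type, i.e. solutions with flat free surface $\eta=\mathrm{const}$,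 vanishing velocity $\mathbf{v}=\mathbf{0}$ and arbitrary bottom topography $b(\mathbf{x})$. *)

theory Defs
  imports "HOL-Analysis.Analysis"
begin

type_synonym scalar_field = "real^2 \<Rightarrow> real"
type_synonym vector_field = "real^2 \<Rightarrow> real^2"

text \<open>The differential operators below are total functions; their values are meaningful only at
  points of differentiability, which the scheme therefore requires explicitly.\<close>

definition gradient :: "scalar_field \<Rightarrow> vector_field" where
  "gradient f x = (\<chi> j. frechet_derivative f (at x) (axis j 1))"

definition divergence :: "vector_field \<Rightarrow> scalar_field" where
  "divergence F x = (\<Sum>j\<in>UNIV. frechet_derivative F (at x) (axis j 1) $ j)"

text \<open>Component \<open>i\<close> of the divergence of the tensor product of \<open>v\<close> and \<open>q\<close> is
  \<open>\<Sum>j. \<partial>\<^sub>j (v\<^sub>j q\<^sub>i)\<close>, i.e. the divergence of the vector field \<open>q\<^sub>i v\<close>.\<close>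

definition div_tensor :: "vector_field \<Rightarrow> vector_field \<Rightarrow> vector_field" where
  "div_tensor v q x = (\<chi> i. divergence (\<lambda>y. (q y $ i) *\<^sub>R v y) x)"

definition depth :: "scalar_field \<Rightarrow> scalar_field \<Rightarrow> scalar_field" where
  "depth b \<eta> x = \<eta> x - b x"

text \<open>The state is the pair \<open>(\<eta>, q)\<close>; the velocity is the solution \<open>v\<close> of \<open>q = h v\<close>, which is
  determined wherever the depth \<open>h\<close> is positive.\<close>

definition velocity :: "scalar_field \<Rightarrow> scalar_field \<Rightarrow> vector_field \<Rightarrow> vector_field" where
  "velocity b \<eta> q x = (1 / depth b \<eta> x) *\<^sub>R q x"

definition friction :: "real \<Rightarrow> real \<Rightarrow> scalar_field \<Rightarrow> scalar_field \<Rightarrow> vector_field \<Rightarrow> scalar_field" where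
  "friction g \<kappa> b \<eta> q x = g / (\<kappa>\<^sup>2 * depth b \<eta> x powr (4/3)) * norm (velocity b \<eta> q x)"

definition explicit_momentum :: "real \<Rightarrow> scalar_field \<Rightarrow> scalar_field \<Rightarrow> vector_field \<Rightarrow> vector_field" where
  "explicit_momentum \<Delta>t b \<eta> q x = q x - \<Delta>t *\<^sub>R div_tensor (velocity b \<eta> q) q x"

text \<open>\<open>scheme_step g \<kappa> \<Delta>t \<Omega> b \<eta> q \<eta>' q'\<close>: the state \<open>(\<eta>', q')\<close> at the new time level solves, in the
  classical sense on \<open>\<Omega>\<close>, the equations of the scheme with data \<open>(\<eta>, q)\<close> at the old time level.
  The first four conjuncts say that everything differentiated in the scheme is differentiable.\<close>

definition scheme_step ::
  "real \<Rightarrow> real \<Rightarrow> real \<Rightarrow> (real^2) set \<Rightarrow> scalar_field \<Rightarrow>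
   scalar_field \<Rightarrow> vector_field \<Rightarrow> scalar_field \<Rightarrow> vector_field \<Rightarrow> bool" where
  "scheme_step g \<kappa> \<Delta>t \<Omega> b \<eta> q \<eta>' q' \<longleftrightarrow>
    (let h = depth b \<eta>;
         v = velocity b \<eta> q;
         \<gamma> = friction g \<kappa> b \<eta> q;
         qs = explicit_momentum \<Delta>t b \<eta> q;
         F = (\<lambda>y. (h y / (1 + \<Delta>t * \<gamma> y)) *\<^sub>R gradient \<eta>' y);
         G = (\<lambda>y. (1 / (1 + \<Delta>t * \<gamma> y)) *\<^sub>R qs y)
     in \<forall>x\<in>\<Omega>.
          (\<forall>i. (\<lambda>y. (q y $ i) *\<^sub>R v y) differentiable (at x)) \<and>
          \<eta>' differentiable (at x) \<and>
          F differentiable (at x) \<and>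
          G differentiable (at x) \<and>
          \<eta>' x - \<Delta>t\<^sup>2 * g * divergence F x = \<eta> x - \<Delta>t * divergence G x \<and>
          q' x = (1 / (1 + \<Delta>t * \<gamma> x)) *\<^sub>R (qs x - (\<Delta>t * g * h x) *\<^sub>R gradient \<eta>' x))"

text \<open>A scheme is given as a relation between the bottom elevation, the old state \<open>(\<eta>, q)\<close> and
  the new state \<open>(\<eta>', q')\<close>. Fields are constrained on \<open>\<Omega>\<close> only, and no regularity of \<open>b\<close> is
  assumed.\<close>

definition well_balanced ::
  "(real^2) set \<Rightarrow>
   (scalar_field \<Rightarrow> scalar_field \<Rightarrow> vector_field \<Rightarrow> scalar_field \<Rightarrow> vector_field \<Rightarrow> bool) \<Rightarrow> bool" where
  "well_balanced \<Omega> S \<longleftrightarrow>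
    (\<forall>b \<eta>\<^sub>0 \<eta> q \<eta>' q'.
       (\<forall>x\<in>\<Omega>. \<eta>\<^sub>0 - b x > 0) \<longrightarrow>
       (\<forall>x\<in>\<Omega>. \<eta> x = \<eta>\<^sub>0 \<and> velocity b \<eta> q x = 0) \<longrightarrow>
       (\<forall>x\<in>\<Omega>. \<eta>' x = \<eta>\<^sub>0 \<and> q' x = 0) \<longrightarrow>
       S b \<eta> q \<eta>' q')"

end

theory Submission
  imports Defs
begin

text \<open>Every quantity that the scheme differentiates is constant on \<open>\<Omega>\<close> at a lake at rest.
  Since the depth is positive there, vanishing velocity forces vanishing momentum, so the
  advective flux and the predicted momentum vanish on \<open>\<Omega>\<close>; the new surface is flat, so its
  gradient vanishes and with it the pressure flux, whatever the topography \<open>b\<close> hidden in the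
  depth factor. Fields are only prescribed on \<open>\<Omega>\<close>, but \<open>\<Omega>\<close> is open and derivatives are local,
  so a field that is constant on \<open>\<Omega>\<close> has derivative zero at each of its points
  (\<open>has_derivative_zero_if_constant_on_open\<close>). Both equations of the scheme then reduce to
  \<open>\<eta>\<^sub>0 = \<eta>\<^sub>0\<close> and \<open>0 = 0\<close>.

  A product rule cannot be applied to the fluxes, since \<open>b\<close> is arbitrary and may be nowhere
  differentiable; instead each flux is recognised as zero on \<open>\<Omega>\<close> before it is differentiated.\<close>

lemma has_derivative_zero_if_constant_on_open:
  fixes f :: "'a::real_normed_vector \<Rightarrow> 'b::real_normed_vector"
  assumes "open S" "x \<in> S" "\<And>y. y \<in> S \<Longrightarrow> f y = c"
  shows "(f has_derivative (\<lambda>_. 0)) (at x)"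
  by (rule has_derivative_transform_within_open[OF has_derivative_const[of c] assms(1,2)])
    (simp add: assms(3))

lemma differentiable_if_constant_on_open:
  fixes f :: "'a::real_normed_vector \<Rightarrow> 'b::real_normed_vector"
  assumes "open S" "x \<in> S" "\<And>y. y \<in> S \<Longrightarrow> f y = c"
  shows "f differentiable (at x)"
  using assms by (intro differentiableI) (rule has_derivative_zero_if_constant_on_open)

lemma gradient_eq_0_if_constant_on_open:
  assumes "open S" "x \<in> S" "\<And>y. y \<in> S \<Longrightarrow> f y = c"
  shows "gradient f x = 0"
proof -
  have "(f has_derivative (\<lambda>_. 0)) (at x)"
    using assms by (rule has_derivative_zero_if_constant_on_open)
  from frechet_derivative_at[OF this, symmetric] show ?thesis
    by (simp add: gradient_def vec_eq_iff)
qed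

lemma divergence_eq_0_if_constant_on_open:
  assumes "open S" "x \<in> S" "\<And>y. y \<in> S \<Longrightarrow> F y = c"
  shows "divergence F x = 0"
proof -
  have "(F has_derivative (\<lambda>_. 0)) (at x)"
    using assms by (rule has_derivative_zero_if_constant_on_open)
  from frechet_derivative_at[OF this, symmetric] show ?thesis
    by (simp add: divergence_def)
qed

lemma momentum_eq_0_if_velocity_eq_0:
  assumes "depth b \<eta> x > 0" "velocity b \<eta> q x = 0"
  shows "q x = 0"
  using assms by (simp add: velocity_def)

lemma explicit_momentum_eq_0_if_at_rest:
  assumes "open S" "x \<in> S" "\<And>y. y \<in> S \<Longrightarrow> q y = 0"
  shows "explicit_momentum \<Delta>t b \<eta> q x = 0"
proof -
  have "divergence (\<lambda>y. (q y $ i) *\<^sub>R velocity b \<eta> q y) x = 0" for i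
    by (rule divergence_eq_0_if_constant_on_open[OF assms(1,2), where c = 0])
      (simp add: assms(3))
  then show ?thesis
    using assms by (simp add: explicit_momentum_def div_tensor_def vec_eq_iff)
qed

theorem proposition1:
  fixes \<Omega> :: "(real^2) set" and g \<kappa>\<^sub>s \<Delta>t :: real
  assumes "open \<Omega>" and "g > 0" and "\<kappa>\<^sub>s > 0" and "\<Delta>t > 0"
  shows "well_balanced \<Omega> (scheme_step g \<kappa>\<^sub>s \<Delta>t \<Omega>)"
  unfolding well_balanced_def
proof (intro allI impI)
  fix b :: scalar_field and \<eta>\<^sub>0 :: real and \<eta> \<eta>' :: scalar_field and q q' :: vector_field
  assume depth_pos: "\<forall>x\<in>\<Omega>. \<eta>\<^sub>0 - b x > 0"
    and old: "\<forall>x\<in>\<Omega>. \<eta> x = \<eta>\<^sub>0 \<and> velocity b \<eta> q x = 0"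
    and new: "\<forall>x\<in>\<Omega>. \<eta>' x = \<eta>\<^sub>0 \<and> q' x = 0"
  define F where "F = (\<lambda>y. (depth b \<eta> y / (1 + \<Delta>t * friction g \<kappa>\<^sub>s b \<eta> q y)) *\<^sub>R gradient \<eta>' y)"
  define G where "G = (\<lambda>y. (1 / (1 + \<Delta>t * friction g \<kappa>\<^sub>s b \<eta> q y)) *\<^sub>R
    explicit_momentum \<Delta>t b \<eta> q y)"
  have q0: "q y = 0" if "y \<in> \<Omega>" for y
  proof (rule momentum_eq_0_if_velocity_eq_0[where q = q and x = y])
    show "depth b \<eta> y > 0"
      using that depth_pos old by (simp add: depth_def)
    show "velocity b \<eta> q y = 0"
      using that old by blast
  qed
  have qs0: "explicit_momentum \<Delta>t b \<eta> q y = 0" if "y \<in> \<Omega>" for y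
    using \<open>open \<Omega>\<close> that q0 by (rule explicit_momentum_eq_0_if_at_rest)
  have grad0: "gradient \<eta>' y = 0" if "y \<in> \<Omega>" for y
    by (rule gradient_eq_0_if_constant_on_open[OF \<open>open \<Omega>\<close> that, where c = \<eta>\<^sub>0]) (simp add: new)
  have F0: "F y = 0" if "y \<in> \<Omega>" for y
    using that by (simp add: F_def grad0)
  have G0: "G y = 0" if "y \<in> \<Omega>" for y
    using that by (simp add: G_def qs0)
  have "(\<forall>i. (\<lambda>y. (q y $ i) *\<^sub>R velocity b \<eta> q y) differentiable (at x)) \<and>
        \<eta>' differentiable (at x) \<and> F differentiable (at x) \<and> G differentiable (at x) \<and>
        \<eta>' x - \<Delta>t\<^sup>2 * g * divergence F x = \<eta> x - \<Delta>t * divergence G x \<and>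
        q' x = (1 / (1 + \<Delta>t * friction g \<kappa>\<^sub>s b \<eta> q x)) *\<^sub>R
          (explicit_momentum \<Delta>t b \<eta> q x - (\<Delta>t * g * depth b \<eta> x) *\<^sub>R gradient \<eta>' x)"
    if x: "x \<in> \<Omega>" for x
  proof (intro conjI allI)
    show "(\<lambda>y. (q y $ i) *\<^sub>R velocity b \<eta> q y) differentiable (at x)" for i
      by (rule differentiable_if_constant_on_open[OF \<open>open \<Omega>\<close> x, where c = 0]) (simp add: q0)
    show "\<eta>' differentiable (at x)"
      by (rule differentiable_if_constant_on_open[OF \<open>open \<Omega>\<close> x, where c = \<eta>\<^sub>0]) (simp add: new)
    show "F differentiable (at x)"
      using \<open>open \<Omega>\<close> x F0 by (rule differentiable_if_constant_on_open)
    show "G differentiable (at x)"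
      using \<open>open \<Omega>\<close> x G0 by (rule differentiable_if_constant_on_open)
    have "divergence F x = 0"
      using \<open>open \<Omega>\<close> x F0 by (rule divergence_eq_0_if_constant_on_open)
    moreover have "divergence G x = 0"
      using \<open>open \<Omega>\<close> x G0 by (rule divergence_eq_0_if_constant_on_open)
    ultimately show "\<eta>' x - \<Delta>t\<^sup>2 * g * divergence F x = \<eta> x - \<Delta>t * divergence G x"
      using old new x by simp
    show "q' x = (1 / (1 + \<Delta>t * friction g \<kappa>\<^sub>s b \<eta> q x)) *\<^sub>R
        (explicit_momentum \<Delta>t b \<eta> q x - (\<Delta>t * g * depth b \<eta> x) *\<^sub>R gradient \<eta>' x)"
      using new x by (simp add: qs0 grad0)
  qed
  then show "scheme_step g \<kappa>\<^sub>s \<Delta>t \<Omega> b \<eta> q \<eta>' q'"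
    unfolding scheme_step_def Let_def F_def G_def by (intro ballI)
qed

end
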